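(* Let $\Omega\subset\mathbb{R}^n$ be a bounded open set, let $B\in C^1(\Omega\times\mathbb{R}\times\mathbb{R}^n;\mathbb{R}^n)$ and $c\in C(\Omega\times\mathbb{R}\times\mathbb{R}^n)$, and let $\tau_1,\tau_2\in\mathbb{R}$ with $\tau_2<\tau_1$. Then there does not exist a Lipschitz continuous function $u$ on $\bar\Omega$ such that simultaneously: (i) $u$ is a viscosity subsolution of $B(x,u,Du)\cdot D^2u\cdot B(x,u,Du)+c(x,u,Du)=\tau_1$ in $\Omega$; (ii) $u$ is a viscosity supersolution of $B(x,u,Du)\cdot D^2u\cdot B(x,u,Du)+c(x,u,Du)=\tau_2$ in $\Omega$; (iii) $u=0$ on $\partial\Omega$.
   Context: For $p\in\mathbb{R}^n$ and an $n\times n$ matrix $A$, $p\cdot A\cdot p$ means $p\cdot(Ap)$. Viscosity sense for an equation $B(x,u,Du)\cdot D^2u\cdot B(x,u,Du)+c(x,u,Du)=h(x)$: a continuous $u$ is a viscosity subsolution in $\Omega$ if whenever $\phi\in C^2(\Omega)$, $x_0\in\Omega$ and $u-\phi$ has a local maximum at $x_0$, then $B(x_0,u(x_0),D\phi(x_0))\cdot D^2\phi(x_0)\cdot B(x_0,u(x_0),D\phi(x_0))+c(x_0,u(x_0),D\phi(x_0))\ge h(x_0)$; it is a viscosity supersolution if whenever $u-\phi$ has a local minimum at $x_0$, the same expression is $\le h(x_0)$. *)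

theory Defs
  imports "HOL-Analysis.Analysis"
begin

definition C1_on :: "'a::real_normed_vector set \<Rightarrow> ('a \<Rightarrow> 'b::real_normed_vector) \<Rightarrow> bool" where
  "C1_on S f \<longleftrightarrow> (\<exists>f'. (\<forall>y\<in>S. (f has_derivative blinfun_apply (f' y)) (at y)) \<and> continuous_on S f')"

definition C2_test :: "(real^'n) set \<Rightarrow> (real^'n \<Rightarrow> real) \<Rightarrow> (real^'n \<Rightarrow> real^'n)
    \<Rightarrow> (real^'n \<Rightarrow> ((real^'n) \<Rightarrow>\<^sub>L (real^'n))) \<Rightarrow> bool" where
  "C2_test S phi Dphi Hphi \<longleftrightarrow>
     (\<forall>y\<in>S. GDERIV phi y :> Dphi y) \<and>
     (\<forall>y\<in>S. (Dphi has_derivative blinfun_apply (Hphi y)) (at y)) \<and>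
     continuous_on S Hphi"

definition local_max_on :: "(real^'n) set \<Rightarrow> (real^'n \<Rightarrow> real) \<Rightarrow> real^'n \<Rightarrow> bool" where
  "local_max_on S f x0 \<longleftrightarrow> (\<exists>e>0. \<forall>y\<in>S \<inter> ball x0 e. f y \<le> f x0)"

definition local_min_on :: "(real^'n) set \<Rightarrow> (real^'n \<Rightarrow> real) \<Rightarrow> real^'n \<Rightarrow> bool" where
  "local_min_on S f x0 \<longleftrightarrow> (\<exists>e>0. \<forall>y\<in>S \<inter> ball x0 e. f x0 \<le> f y)"

definition visc_sub :: "(real^'n) set \<Rightarrow> ((real^'n) \<times> real \<times> (real^'n) \<Rightarrow> real^'n)
    \<Rightarrow> ((real^'n) \<times> real \<times> (real^'n) \<Rightarrow> real) \<Rightarrow> (real^'n \<Rightarrow> real) \<Rightarrow> (real^'n \<Rightarrow> real) \<Rightarrow> bool" where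
  "visc_sub \<Omega> B c h u \<longleftrightarrow> continuous_on \<Omega> u \<and>
     (\<forall>phi Dphi Hphi x0. C2_test \<Omega> phi Dphi Hphi \<and> x0 \<in> \<Omega> \<and> local_max_on \<Omega> (\<lambda>x. u x - phi x) x0 \<longrightarrow>
        (let b = B (x0, u x0, Dphi x0) in b \<bullet> (Hphi x0 b) + c (x0, u x0, Dphi x0) \<ge> h x0))"

definition visc_super :: "(real^'n) set \<Rightarrow> ((real^'n) \<times> real \<times> (real^'n) \<Rightarrow> real^'n)
    \<Rightarrow> ((real^'n) \<times> real \<times> (real^'n) \<Rightarrow> real) \<Rightarrow> (real^'n \<Rightarrow> real) \<Rightarrow> (real^'n \<Rightarrow> real) \<Rightarrow> bool" where
  "visc_super \<Omega> B c h u \<longleftrightarrow> continuous_on \<Omega> u \<and>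
     (\<forall>phi Dphi Hphi x0. C2_test \<Omega> phi Dphi Hphi \<and> x0 \<in> \<Omega> \<and> local_min_on \<Omega> (\<lambda>x. u x - phi x) x0 \<longrightarrow>
        (let b = B (x0, u x0, Dphi x0) in b \<bullet> (Hphi x0 b) + c (x0, u x0, Dphi x0) \<le> h x0))"

end

theory Submission
  imports Defs
begin

text \<open>
  Let \<open>(x, y)\<close> maximise \<open>u v - u w - |v - w|\<^sup>2 / (2\<epsilon>) - \<eta> |v - z|\<^sup>2\<close> over a small ball around an interior
  point \<open>z\<close>. As \<open>u\<close> is Lipschitz, \<open>|x - y| = O(\<epsilon>)\<close>, so the vectors \<open>a\<close> and \<open>b\<close> which \<open>B\<close> takes at \<open>x\<close> and at
  \<open>y\<close> satisfy \<open>|a - b| = O(\<epsilon> + \<eta>)\<close>. Only the second derivatives of \<open>u\<close> along \<open>a\<close> at \<open>x\<close> and along \<open>b\<close> at \<open>y\<close>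
  enter the equation, and for these the theorem on sums is not needed: a subsolution that is touched from
  above at \<open>x\<close> has a second difference along \<open>a\<close> of at least \<open>(\<tau>1 - c - o(1)) s\<^sup>2\<close>, up to small displacements
  transversal to \<open>a\<close>, since otherwise a quadratic with a smaller second derivative along \<open>a\<close> and a steep
  transversal part would touch \<open>u\<close> from above near \<open>x\<close>. Subtracting the analogous bound at \<open>y\<close> and using
  maximality gives \<open>\<tau>1 - \<tau>2 \<le> o(1) + O(|a - b|\<^sup>2 / \<epsilon> + \<eta>)\<close>, which tends to \<open>0\<close> when \<open>\<epsilon> \<ll> \<eta> \<ll> \<surd>\<epsilon>\<close>.
\<close>

section \<open>Second differences along one direction\<close>

text \<open>Take a cylinder about \<open>x\<close> with axis \<open>a\<close> and size proportional
  to \<open>s\<close>. The form \<open>H\<close> has second derivative \<open>\<alpha>\<close> along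
  \<open>a\<close> and \<open>2 * N\<close> across it. If the first alternative fails, a quadratic
  with Hessian \<open>H\<close> that dominates \<open>u\<close> on the two end faces lies strictly
  below \<open>u\<close> at the centre. As \<open>N > C\<close>, it also dominates \<open>u\<close>
  on the lateral side of a wide enough cylinder, so after a vertical shift it touches
  \<open>u\<close> from above at an interior point.\<close>

lemma second_difference_or_touching:
  fixes u :: "'a::euclidean_space \<Rightarrow> real" and H :: "'a \<Rightarrow>\<^sub>L 'a"
  assumes "R > 0" and cont: "continuous_on (cball x R) u"
    and upper: "\<And>d. norm d \<le> R \<Longrightarrow> u (x + d) \<le> u x + p \<bullet> d + C * (norm d)\<^sup>2"
    and C: "0 \<le> C" "C < N" and a: "a \<noteq> 0"
    and H: "\<And>d. H d = (2 * N) *\<^sub>R d + ((\<alpha> / (a \<bullet> a)\<^sup>2 - 2 * N / (a \<bullet> a)) * (a \<bullet> d)) *\<^sub>R a"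
    and "\<delta> > 0"
  shows "\<forall>\<^sub>F s in at_right 0.
    (\<exists>d e. norm (s *\<^sub>R a + d) \<le> R \<and> norm (e - s *\<^sub>R a) \<le> R \<and>
       \<alpha> * s\<^sup>2 \<le> u (x + (s *\<^sub>R a + d)) + u (x + (e - s *\<^sub>R a)) - 2 * u x
                  - p \<bullet> (d + e) - N * ((norm d)\<^sup>2 + (norm e)\<^sup>2)) \<or>
    (\<exists>y g. norm (y - x) < \<delta> \<and> norm (g - p) < \<delta> \<and>
       (\<forall>\<^sub>F v in nhds y. u v \<le> u y + g \<bullet> (v - y) + (v - y) \<bullet> H (v - y) / 2))"
proof -
  \<comment> \<open>In the orthogonal splitting of \<open>d\<close> into
    \<open>\<sigma> d *\<^sub>R a\<close> and \<open>P d\<close> the quadratic form of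
    \<open>H\<close> is diagonal, namely \<open>q\<close>. The function \<open>w\<close> is
    \<open>u\<close> without its affine part of slope \<open>p\<close>.\<close>
  define \<sigma> where "\<sigma> d = (a \<bullet> d) / (a \<bullet> a)" for d
  define P where "P d = d - \<sigma> d *\<^sub>R a" for d
  define q where "q d = N * (norm (P d))\<^sup>2 + \<alpha> / 2 * (\<sigma> d)\<^sup>2" for d
  define w where "w d = u (x + d) - u x - p \<bullet> d" for d
  have aa: "a \<bullet> a > 0" using a by simp
  have P_norm: "(norm (P d))\<^sup>2 = d \<bullet> d - (a \<bullet> d)\<^sup>2 / (a \<bullet> a)" for d
    using aa unfolding power2_norm_eq_inner P_def \<sigma>_def
    by (simp add: inner_diff_left inner_diff_right inner_commute power2_eq_square field_simps)
  have pythagoras: "(norm d)\<^sup>2 = (\<sigma> d)\<^sup>2 * (a \<bullet> a) + (norm (P d))\<^sup>2" for d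
    using aa unfolding power2_norm_eq_inner[of d] P_norm \<sigma>_def
    by (simp add: power2_eq_square field_simps)
  have q_H: "q d = d \<bullet> H d / 2" for d
    using aa unfolding q_def P_norm \<sigma>_def H
    by (simp add: inner_add_right inner_commute power2_eq_square field_simps)
  have H_sym: "d \<bullet> H e = e \<bullet> H d" for d e
    unfolding H by (simp add: inner_add_right inner_commute)
  have q_expand: "q d = q e + H e \<bullet> (d - e) + q (d - e)" for d e
    unfolding q_H using H_sym[of d e]
    by (simp add: blinfun.diff_right inner_diff_left inner_diff_right inner_commute field_simps)
  have \<sigma>_cont: "continuous_on S \<sigma>" for S
    unfolding \<sigma>_def by (intro continuous_intros) (use aa in auto)
  have P_cont: "continuous_on S P" for S
    unfolding P_def by (intro continuous_intros \<sigma>_cont)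
  have q_cont: "continuous_on S q" for S
    unfolding q_def by (intro continuous_intros \<sigma>_cont P_cont)
  have w_cont: "continuous_on S w" if "S \<subseteq> cball 0 R" for S
    unfolding w_def
    by (intro continuous_intros continuous_on_compose2[OF cont]) (use that in \<open>auto simp: dist_norm\<close>)
  have w_upper: "w d \<le> C * (norm d)\<^sup>2" if "norm d \<le> R" for d
    using upper[OF that] by (simp add: w_def)

  \<comment> \<open>\<open>K\<close> is so large that replacing a face maximum by
    \<open>- K * s\<^sup>2\<close> cannot lift the sum of both to
    \<open>\<alpha> * s\<^sup>2\<close>. \<open>\<rho>\<close> is the width at which the surplus
    \<open>N - C\<close> outweighs all other terms on the lateral side. \<open>M\<close> and
    \<open>M'\<close> control the distances of the touching point from \<open>x\<close> and of its
    slope from \<open>p\<close>, per unit of \<open>s\<close>.\<close>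
  define K where "K = C * (a \<bullet> a) + \<bar>\<alpha>\<bar> + 1"
  define \<rho> where "\<rho> = sqrt ((C * (a \<bullet> a) + 2 * K + \<bar>\<alpha>\<bar>) / (N - C))"
  define M where "M = norm a + \<rho>"
  have K: "K > 0" using C aa by (simp add: K_def add_nonneg_pos)
  have \<rho>_sq: "(N - C) * \<rho>\<^sup>2 = C * (a \<bullet> a) + 2 * K + \<bar>\<alpha>\<bar>"
    using C K aa by (simp add: \<rho>_def)
  have \<rho>: "\<rho> > 0"
  proof -
    have "0 < C * (a \<bullet> a) + 2 * K + \<bar>\<alpha>\<bar>"
      using C K aa by (intro add_pos_nonneg add_nonneg_pos) auto
    then show ?thesis using C by (simp add: \<rho>_def)
  qed
  have M: "M > 0" using \<rho> a by (simp add: M_def add_pos_pos)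
  define M' where "M' = K / norm a + norm H * M"
  have M': "M' > 0" using K M a by (simp add: M'_def add_pos_nonneg)

  define s0 where "s0 = min (R / M) (min (\<delta> / M) (\<delta> / M'))"
  have "s0 > 0" using M M' \<open>R > 0\<close> \<open>\<delta> > 0\<close> by (simp add: s0_def)
  moreover have
    "(\<exists>d e. norm (s *\<^sub>R a + d) \<le> R \<and> norm (e - s *\<^sub>R a) \<le> R \<and>
       \<alpha> * s\<^sup>2 \<le> u (x + (s *\<^sub>R a + d)) + u (x + (e - s *\<^sub>R a)) - 2 * u x
                  - p \<bullet> (d + e) - N * ((norm d)\<^sup>2 + (norm e)\<^sup>2)) \<or>
    (\<exists>y g. norm (y - x) < \<delta> \<and> norm (g - p) < \<delta> \<and>
       (\<forall>\<^sub>F v in nhds y. u v \<le> u y + g \<bullet> (v - y) + (v - y) \<bullet> H (v - y) / 2))"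
    (is "?A \<or> ?T") if s: "0 < s" "s < s0" for s
  proof -
    have sR: "s * M \<le> R" and s\<delta>: "s * M < \<delta>" "s * M' < \<delta>"
      using s M M' by (auto simp: s0_def field_simps)
    \<comment> \<open>\<open>D\<close> is the cylinder, \<open>F\<^sub>p\<close> and
      \<open>F\<^sub>m\<close> are its end faces.\<close>
    define D where "D = {d. \<bar>\<sigma> d\<bar> \<le> s \<and> norm (P d) \<le> \<rho> * s}"
    define F\<^sub>p where "F\<^sub>p = D \<inter> {d. \<sigma> d = s}"
    define F\<^sub>m where "F\<^sub>m = D \<inter> {d. \<sigma> d = - s}"
    have D_norm: "norm d \<le> s * M" if "d \<in> D" for d
    proof -
      have "norm d \<le> norm (P d) + norm (\<sigma> d *\<^sub>R a)"
        unfolding P_def by (metis norm_triangle_ineq diff_add_cancel)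
      also have "\<dots> \<le> \<rho> * s + s * norm a"
        using that by (intro add_mono) (auto simp: D_def intro: mult_right_mono)
      finally show ?thesis by (simp add: M_def algebra_simps)
    qed
    have D_R: "D \<subseteq> cball 0 R" using D_norm sR by fastforce
    have "closed D"
      unfolding D_def by (intro closed_Collect_conj closed_Collect_le continuous_intros \<sigma>_cont P_cont)
    then have D: "compact D"
      using D_R by (meson bounded_cball bounded_subset compact_eq_bounded_closed)
    have Fp: "compact F\<^sub>p" and Fm: "compact F\<^sub>m"
      unfolding F\<^sub>p_def F\<^sub>m_def
      by (intro compact_Int_closed D closed_Collect_eq continuous_intros \<sigma>_cont)+
    have \<sigma>_a: "\<sigma> (s *\<^sub>R a) = s" "\<sigma> (- s *\<^sub>R a) = - s" and P_a: "P (s *\<^sub>R a) = 0" "P (- s *\<^sub>R a) = 0"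
      using aa by (simp_all add: \<sigma>_def P_def)
    have ne: "s *\<^sub>R a \<in> F\<^sub>p" "- s *\<^sub>R a \<in> F\<^sub>m"
      unfolding F\<^sub>p_def F\<^sub>m_def D_def using s \<rho> \<sigma>_a P_a by auto
    define G where "G d = w d - N * (norm (P d))\<^sup>2" for d
    have G_cont: "continuous_on D G"
      unfolding G_def by (intro continuous_intros w_cont D_R P_cont)
    have G_upper: "G d \<le> C * (a \<bullet> a) * s\<^sup>2 - (N - C) * (norm (P d))\<^sup>2" if "d \<in> D" for d
    proof -
      have "(\<sigma> d)\<^sup>2 \<le> s\<^sup>2" using that s by (auto simp: D_def abs_le_square_iff[symmetric])
      then have "C * ((\<sigma> d)\<^sup>2 * (a \<bullet> a)) \<le> C * (s\<^sup>2 * (a \<bullet> a))"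
        using C aa by (intro mult_left_mono mult_right_mono) auto
      then show ?thesis
        using w_upper[of d] that D_R unfolding G_def pythagoras[of d]
        by (auto simp: algebra_simps)
    qed
    have "\<exists>d\<in>F\<^sub>p. \<forall>e\<in>F\<^sub>p. G e \<le> G d"
      using ne by (intro continuous_attains_sup Fp continuous_on_subset[OF G_cont]) (auto simp: F\<^sub>p_def)
    then obtain dp where dp: "dp \<in> F\<^sub>p" "\<And>e. e \<in> F\<^sub>p \<Longrightarrow> G e \<le> G dp" by blast
    have "\<exists>d\<in>F\<^sub>m. \<forall>e\<in>F\<^sub>m. G e \<le> G d"
      using ne by (intro continuous_attains_sup Fm continuous_on_subset[OF G_cont]) (auto simp: F\<^sub>m_def)
    then obtain dm where dm: "dm \<in> F\<^sub>m" "\<And>e. e \<in> F\<^sub>m \<Longrightarrow> G e \<le> G dm" by blast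
    have face_upper: "G dp \<le> C * (a \<bullet> a) * s\<^sup>2" "G dm \<le> C * (a \<bullet> a) * s\<^sup>2"
      using G_upper[of dp] G_upper[of dm] dp(1) dm(1) C
      by (auto simp: F\<^sub>p_def F\<^sub>m_def intro: order_trans)
    show ?thesis
    proof (cases "\<alpha> * s\<^sup>2 \<le> G dp + G dm")
      case True
      \<comment> \<open>The transversal parts of the two face maximisers serve as the
        displacements.\<close>
      have "s *\<^sub>R a + P dp = dp" "P dm - s *\<^sub>R a = dm"
        using dp(1) dm(1) by (auto simp: F\<^sub>p_def F\<^sub>m_def P_def)
      moreover have "norm dp \<le> R" "norm dm \<le> R"
        using dp(1) dm(1) D_R by (auto simp: F\<^sub>p_def F\<^sub>m_def)
      moreover have "p \<bullet> (P dp + P dm) = p \<bullet> dp + p \<bullet> dm"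
        using dp(1) dm(1) by (simp add: F\<^sub>p_def F\<^sub>m_def P_def inner_add_right inner_diff_right)
      ultimately have ?A
        using True by - (rule exI[of _ "P dp"], rule exI[of _ "P dm"], simp add: G_def w_def ring_distribs)
      then show ?thesis ..
    next
      case False
      \<comment> \<open>The truncation at \<open>- K * s\<^sup>2\<close> keeps the slope \<open>m\<close> of the touching quadratic of order \<open>s\<close>.\<close>
      define Lp where "Lp = max (G dp) (- K * s\<^sup>2)"
      define Lm where "Lm = max (G dm) (- K * s\<^sup>2)"
      \<comment> \<open>\<open>A + m * \<sigma> + \<alpha> / 2 * \<sigma>\<^sup>2\<close> is the
        parabola with the values \<open>Lp\<close> at \<open>s\<close> and \<open>Lm\<close> at
        \<open>- s\<close>. Its value \<open>A\<close> at the centre is negative because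
        \<open>Lp + Lm < \<alpha> * s\<^sup>2\<close>.\<close>
      define m where "m = (Lp - Lm) / (2 * s)"
      define A where "A = (Lp + Lm) / 2 - \<alpha> * s\<^sup>2 / 2"
      have s2: "s\<^sup>2 > 0" using s by simp
      have K_split: "K * s\<^sup>2 = C * (a \<bullet> a) * s\<^sup>2 + \<bar>\<alpha>\<bar> * s\<^sup>2 + s\<^sup>2"
        by (simp add: K_def algebra_simps)
      have abs_\<alpha>: "\<bar>\<alpha> * s\<^sup>2\<bar> = \<bar>\<alpha>\<bar> * s\<^sup>2" by (simp add: abs_mult)
      have Ca: "0 \<le> C * (a \<bullet> a) * s\<^sup>2" using C by simp
      have L_bounds: "\<bar>Lp\<bar> \<le> K * s\<^sup>2" "\<bar>Lm\<bar> \<le> K * s\<^sup>2"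
        using face_upper K_split abs_\<alpha> s2 Ca unfolding Lp_def Lm_def by linarith+
      have "Lp + Lm < \<alpha> * s\<^sup>2"
        using False face_upper K_split abs_\<alpha> s2 Ca unfolding Lp_def Lm_def by linarith
      then have "A < 0" by (simp add: A_def)
      have A_lower: "A \<ge> - K * s\<^sup>2 - \<bar>\<alpha>\<bar> * s\<^sup>2 / 2"
      proof -
        have "\<alpha> * s\<^sup>2 \<le> \<bar>\<alpha>\<bar> * s\<^sup>2" by (simp add: mult_right_mono)
        moreover have "- K * s\<^sup>2 \<le> Lp" "- K * s\<^sup>2 \<le> Lm" by (simp_all add: Lp_def Lm_def)
        ultimately show ?thesis unfolding A_def by (simp add: field_simps)
      qed
      have ms: "m * s = (Lp - Lm) / 2" using s by (simp add: m_def)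
      have m_bound: "\<bar>m\<bar> \<le> K * s"
      proof -
        have "\<bar>m\<bar> * s = \<bar>m * s\<bar>" using s by (simp add: abs_mult)
        also have "\<dots> \<le> K * s\<^sup>2" unfolding ms using L_bounds by (simp add: abs_le_iff)
        finally show ?thesis using s by (simp add: power2_eq_square flip: mult.assoc)
      qed
      define F where "F d = w d - q d - m * \<sigma> d - A" for d
      have F_G: "F d = G d - (A + m * \<sigma> d + \<alpha> / 2 * (\<sigma> d)\<^sup>2)" for d
        by (simp add: F_def G_def q_def)
      have "\<exists>d\<in>D. \<forall>e\<in>D. F e \<le> F d"
        unfolding F_def using ne
        by (intro continuous_attains_sup D continuous_intros w_cont D_R q_cont \<sigma>_cont)
           (auto simp: F\<^sub>p_def)
      then obtain d where d: "d \<in> D" "\<And>e. e \<in> D \<Longrightarrow> F e \<le> F d" by blast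
      have "0 \<in> D" "F 0 = - A"
        using s \<rho> by (auto simp: D_def F_def w_def q_def \<sigma>_def P_def)
      then have F_pos: "F d > 0" using d(2) \<open>A < 0\<close> by fastforce
      \<comment> \<open>The maximiser \<open>d\<close> avoids the boundary of \<open>D\<close>,
        since \<open>F d > 0\<close>: on the end faces \<open>F\<close> is at most \<open>0\<close>
        by the choice of \<open>Lp\<close> and \<open>Lm\<close>, on the lateral side by the choice
        of \<open>\<rho>\<close>.\<close>
      have \<sigma>_lt: "\<bar>\<sigma> d\<bar> < s"
      proof (rule ccontr)
        assume "\<not> \<bar>\<sigma> d\<bar> < s"
        then consider "d \<in> F\<^sub>p" | "d \<in> F\<^sub>m"
          using d(1) by (fastforce simp: F\<^sub>p_def F\<^sub>m_def D_def)
        then show False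
        proof cases
          case 1
          then have "F d = G d - Lp"
            using ms by (simp add: F_G F\<^sub>p_def A_def field_simps)
          also have "\<dots> \<le> 0" using dp(2)[OF 1] by (simp add: Lp_def)
          finally show False using F_pos by simp
        next
          case 2
          then have "F d = G d - Lm"
            using ms by (simp add: F_G F\<^sub>m_def A_def field_simps)
          also have "\<dots> \<le> 0" using dm(2)[OF 2] by (simp add: Lm_def)
          finally show False using F_pos by simp
        qed
      qed
      have P_lt: "norm (P d) < \<rho> * s"
      proof (rule ccontr)
        assume "\<not> norm (P d) < \<rho> * s"
        then have "norm (P d) = \<rho> * s" using d(1) by (auto simp: D_def)
        then have "(N - C) * (norm (P d))\<^sup>2 = ((N - C) * \<rho>\<^sup>2) * s\<^sup>2"
          by (simp add: power_mult_distrib)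
        also have "\<dots> = C * (a \<bullet> a) * s\<^sup>2 + 2 * (K * s\<^sup>2) + \<bar>\<alpha>\<bar> * s\<^sup>2"
          unfolding \<rho>_sq by (simp add: algebra_simps)
        finally have "G d \<le> - 2 * (K * s\<^sup>2) - \<bar>\<alpha>\<bar> * s\<^sup>2"
          using G_upper[OF d(1)] by simp
        moreover have "\<bar>m * \<sigma> d\<bar> \<le> K * s\<^sup>2"
          using m_bound \<sigma>_lt mult_mono[of "\<bar>m\<bar>" "K * s" "\<bar>\<sigma> d\<bar>" s] K s
          by (simp add: abs_mult power2_eq_square)
        moreover have "\<bar>\<alpha> / 2 * (\<sigma> d)\<^sup>2\<bar> \<le> \<bar>\<alpha>\<bar> / 2 * s\<^sup>2"
        proof -
          have "(\<sigma> d)\<^sup>2 \<le> s\<^sup>2" using \<sigma>_lt s by (auto simp: abs_le_square_iff[symmetric])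
          then have "\<bar>\<alpha>\<bar> / 2 * (\<sigma> d)\<^sup>2 \<le> \<bar>\<alpha>\<bar> / 2 * s\<^sup>2" by (intro mult_left_mono) auto
          then show ?thesis by (simp add: abs_mult)
        qed
        ultimately have "F d \<le> 0"
          using A_lower unfolding F_G by linarith
        then show False using F_pos by simp
      qed
      define y where "y = x + d"
      \<comment> \<open>The gradient of the touching quadratic at \<open>y\<close>.\<close>
      define g where "g = p + (m / (a \<bullet> a)) *\<^sub>R a + H d"
      have "open {d. \<bar>\<sigma> d\<bar> < s \<and> norm (P d) < \<rho> * s}"
        by (intro open_Collect_conj open_Collect_less continuous_intros \<sigma>_cont P_cont)
      then have "\<forall>\<^sub>F e in nhds d. e \<in> {d. \<bar>\<sigma> d\<bar> < s \<and> norm (P d) < \<rho> * s}"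
        using \<sigma>_lt P_lt by (intro eventually_nhds_in_open) auto
      then have "\<forall>\<^sub>F e in nhds d. F e \<le> F d"
        by (rule eventually_mono) (auto simp: D_def intro!: d(2))
      moreover have "filterlim (\<lambda>v. v - x) (nhds d) (nhds y)"
        unfolding y_def by (rule tendsto_eq_intros tendsto_ident_at filterlim_ident | simp)+
      ultimately have "\<forall>\<^sub>F v in nhds y. F (v - x) \<le> F d"
        by (rule eventually_compose_filterlim)
      then have "\<forall>\<^sub>F v in nhds y. u v \<le> u y + g \<bullet> (v - y) + (v - y) \<bullet> H (v - y) / 2"
      proof (rule eventually_mono)
        fix v assume "F (v - x) \<le> F d"
        moreover define e where "e = v - y"
        ultimately have le: "F (d + e) \<le> F d" and v: "v = x + (d + e)"
          by (simp_all add: y_def)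
        have "q (d + e) = q d + H d \<bullet> e + e \<bullet> H e / 2"
          using q_expand[of "d + e" d] q_H[of e] by simp
        moreover have "\<sigma> (d + e) = \<sigma> d + (a \<bullet> e) / (a \<bullet> a)"
          by (simp add: \<sigma>_def inner_add_right add_divide_distrib)
        ultimately have "u v \<le> u y + g \<bullet> e + e \<bullet> H e / 2"
          using le by (simp add: F_def w_def g_def v y_def inner_add_left inner_add_right algebra_simps)
        then show "u v \<le> u y + g \<bullet> (v - y) + (v - y) \<bullet> H (v - y) / 2"
          by (simp add: e_def)
      qed
      moreover have "norm (y - x) < \<delta>"
        using D_norm[OF d(1)] s\<delta> by (simp add: y_def)
      moreover have "norm (g - p) < \<delta>"
      proof -
        have "norm (g - p) \<le> norm ((m / (a \<bullet> a)) *\<^sub>R a) + norm (H d)"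
          unfolding g_def using norm_triangle_ineq[of "(m / (a \<bullet> a)) *\<^sub>R a" "H d"]
          by (simp add: add.assoc)
        also have "norm ((m / (a \<bullet> a)) *\<^sub>R a) = \<bar>m\<bar> / norm a"
          using a by (simp add: power2_norm_eq_inner[symmetric] power2_eq_square)
        also have "\<dots> \<le> K * s / norm a" using m_bound by (simp add: divide_right_mono)
        also have "norm (H d) \<le> norm H * (s * M)"
          using norm_blinfun[of H d] D_norm[OF d(1)]
          by (meson mult_left_mono norm_ge_zero order_trans)
        finally have "norm (g - p) \<le> s * M'" by (simp add: M'_def algebra_simps)
        then show ?thesis using s\<delta> by simp
      qed
      ultimately have ?T by blast
      then show ?thesis ..
    qed
  qed
  ultimately show ?thesis
    unfolding eventually_at_right_field by blast
qed

section \<open>Consequences for viscosity subsolutions\<close>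

lemma C2_test_quadratic:
  fixes H :: "(real^'n) \<Rightarrow>\<^sub>L (real^'n)"
  assumes H_sym: "\<And>d e. d \<bullet> H e = e \<bullet> H d"
  shows "C2_test S (\<lambda>v. g \<bullet> (v - y) + (v - y) \<bullet> H (v - y) / 2) (\<lambda>v. g + H (v - y)) (\<lambda>_. H)"
  unfolding C2_test_def gderiv_def
proof (intro conjI ballI)
  fix v
  show "((\<lambda>v. g \<bullet> (v - y) + (v - y) \<bullet> H (v - y) / 2) has_derivative (\<lambda>h. h \<bullet> (g + H (v - y)))) (at v)"
    by (auto intro!: derivative_eq_intros ext
        simp: H_sym[of "v - y"] inner_add_right inner_commute[of g] inner_commute[of "H _"] blinfun.diff_right)
  show "((\<lambda>v. g + H (v - y)) has_derivative H) (at v)"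
    by (auto intro!: derivative_eq_intros)
qed simp

lemma visc_sub_touching:
  fixes H :: "(real^'n) \<Rightarrow>\<^sub>L (real^'n)"
  assumes sub: "visc_sub \<Omega> B c h u" and "y \<in> \<Omega>" and H_sym: "\<And>d e. d \<bullet> H e = e \<bullet> H d"
    and touch: "\<forall>\<^sub>F v in nhds y. u v \<le> u y + g \<bullet> (v - y) + (v - y) \<bullet> H (v - y) / 2"
  shows "h y \<le> B (y, u y, g) \<bullet> H (B (y, u y, g)) + c (y, u y, g)"
proof -
  have "local_max_on \<Omega> (\<lambda>v. u v - (g \<bullet> (v - y) + (v - y) \<bullet> H (v - y) / 2)) y"
    using touch unfolding local_max_on_def eventually_nhds_metric
    by (fastforce simp: dist_commute)
  with C2_test_quadratic[OF H_sym, of \<Omega> g y] \<open>y \<in> \<Omega>\<close> sub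
  show ?thesis unfolding visc_sub_def Let_def by fastforce
qed

text \<open>The touching alternative contradicts the equation: since
  \<open>a \<bullet> H a = \<alpha>\<close>, the operator evaluated with Hessian \<open>H\<close> at
  \<open>(x, p)\<close> is \<open>\<alpha> + c (x, u x, p) < \<tau>\<close>, and by continuity it
  stays below \<open>\<tau>\<close> at every nearby point and slope.\<close>

lemma visc_sub_second_difference:
  fixes u :: "real^'n \<Rightarrow> real"
  assumes "open \<Omega>" and contB: "continuous_on (\<Omega> \<times> UNIV \<times> UNIV) B"
    and contc: "continuous_on (\<Omega> \<times> UNIV \<times> UNIV) c"
    and sub: "visc_sub \<Omega> B c (\<lambda>_. \<tau>) u"
    and R: "R > 0" "cball x R \<subseteq> \<Omega>"
    and upper: "\<And>d. norm d \<le> R \<Longrightarrow> u (x + d) \<le> u x + p \<bullet> d + C * (norm d)\<^sup>2"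
    and C: "0 \<le> C" "C < N"
    and a: "a = B (x, u x, p)" and \<alpha>: "\<alpha> + c (x, u x, p) < \<tau>"
  shows "\<forall>\<^sub>F s in at_right 0.
    \<exists>d e. norm (s *\<^sub>R a + d) \<le> R \<and> norm (e - s *\<^sub>R a) \<le> R \<and>
       \<alpha> * s\<^sup>2 \<le> u (x + (s *\<^sub>R a + d)) + u (x + (e - s *\<^sub>R a)) - 2 * u x
                  - p \<bullet> (d + e) - N * ((norm d)\<^sup>2 + (norm e)\<^sup>2)"
proof -
  have x: "x \<in> \<Omega>" using R by auto
  have contu: "continuous_on \<Omega> u" using sub by (simp add: visc_sub_def)
  show ?thesis
  proof (cases "a = 0")
    case True
    \<comment> \<open>For \<open>a = 0\<close> the second-order term vanishes. Testing with the
      paraboloid from \<open>upper\<close> then forces \<open>\<alpha> \<le> 0\<close>, and zero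
      displacements suffice.\<close>
    define H :: "(real^'n) \<Rightarrow>\<^sub>L (real^'n)" where "H = (2 * C) *\<^sub>R id_blinfun"
    have "\<forall>\<^sub>F v in nhds x. v \<in> ball x R" using R by (intro eventually_nhds_in_open) auto
    then have "\<forall>\<^sub>F v in nhds x. u v \<le> u x + p \<bullet> (v - x) + (v - x) \<bullet> H (v - x) / 2"
    proof (rule eventually_mono)
      fix v assume "v \<in> ball x R"
      then show "u v \<le> u x + p \<bullet> (v - x) + (v - x) \<bullet> H (v - x) / 2"
        using upper[of "v - x"]
        by (simp add: H_def dist_norm norm_minus_commute power2_norm_eq_inner blinfun.scaleR_left)
    qed
    from visc_sub_touching[OF sub x _ this] have "\<tau> \<le> c (x, u x, p)"
      using True by (simp add: H_def a[symmetric] inner_commute blinfun.scaleR_left)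
    then have "\<alpha> \<le> 0" using \<alpha> by simp
    then have "\<alpha> * s\<^sup>2 \<le> 0" for s by (simp add: mult_nonpos_nonneg)
    then show ?thesis
      using True R by (intro always_eventually allI exI[of _ 0]) auto
  next
    case False
    define k where "k = \<alpha> / (a \<bullet> a)\<^sup>2 - 2 * N / (a \<bullet> a)"
    define H where "H = Blinfun (\<lambda>d. (2 * N) *\<^sub>R d + (k * (a \<bullet> d)) *\<^sub>R a)"
    have H: "H d = (2 * N) *\<^sub>R d + (k * (a \<bullet> d)) *\<^sub>R a" for d
      unfolding H_def
      by (subst bounded_linear_Blinfun_apply) (intro bounded_linear_intros, simp)
    have H_sym: "d \<bullet> H e = e \<bullet> H d" for d e
      unfolding H by (simp add: inner_add_right inner_commute)
    have "a \<bullet> H a = \<alpha>"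
      unfolding H k_def using False
      by (simp add: inner_add_right power2_eq_square field_simps)
    then have lt: "B (x, u x, p) \<bullet> H (B (x, u x, p)) + c (x, u x, p) < \<tau>"
      using \<alpha> by (simp add: a)
    have open_prod: "open (\<Omega> \<times> (UNIV :: (real^'n) set))"
      using \<open>open \<Omega>\<close> by (intro open_Times) auto
    have "continuous_on (\<Omega> \<times> UNIV)
        (\<lambda>(v, g). B (v, u v, g) \<bullet> H (B (v, u v, g)) + c (v, u v, g))"
      unfolding case_prod_beta
      by (intro continuous_intros continuous_on_compose2[OF contB] continuous_on_compose2[OF contc]
          continuous_on_compose2[OF contu]) auto
    then have "isCont (\<lambda>(v, g). B (v, u v, g) \<bullet> H (B (v, u v, g)) + c (v, u v, g)) (x, p)"
      using open_prod x by (simp add: continuous_on_eq_continuous_at)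
    then have "\<forall>\<^sub>F z in nhds (x, p). (\<lambda>(v, g). B (v, u v, g) \<bullet> H (B (v, u v, g)) + c (v, u v, g)) z < \<tau>"
      using lt unfolding continuous_at isCont_def tendsto_at_iff_tendsto_nhds
      by (intro order_tendstoD) auto
    moreover have "\<forall>\<^sub>F z in nhds (x, p). z \<in> \<Omega> \<times> UNIV"
      using open_prod x by (intro eventually_nhds_in_open) auto
    ultimately have "\<forall>\<^sub>F z in nhds (x, p). fst z \<in> \<Omega> \<and>
       B (fst z, u (fst z), snd z) \<bullet> H (B (fst z, u (fst z), snd z)) + c (fst z, u (fst z), snd z) < \<tau>"
      by eventually_elim auto
    then obtain \<delta> where \<delta>: "\<delta> > 0" and near: "\<And>v g. dist (v, g) (x, p) < \<delta> \<Longrightarrow> v \<in> \<Omega> \<and>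
       B (v, u v, g) \<bullet> H (B (v, u v, g)) + c (v, u v, g) < \<tau>"
      unfolding eventually_nhds_metric by force
    have no_touch: False
      if "norm (v - x) < \<delta> / 2" "norm (g - p) < \<delta> / 2"
        and "\<forall>\<^sub>F w in nhds v. u w \<le> u v + g \<bullet> (w - v) + (w - v) \<bullet> H (w - v) / 2" for v g
    proof -
      have "dist (v, g) (x, p) \<le> norm (v - x) + norm (g - p)"
        unfolding dist_Pair_Pair by (simp add: dist_norm sqrt_sum_squares_le_sum)
      then have "v \<in> \<Omega>" "B (v, u v, g) \<bullet> H (B (v, u v, g)) + c (v, u v, g) < \<tau>"
        using near[of v g] that by auto
      then show False
        using visc_sub_touching[OF sub _ H_sym that(3)] by simp
    qed
    have "\<forall>\<^sub>F s in at_right 0.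
      (\<exists>d e. norm (s *\<^sub>R a + d) \<le> R \<and> norm (e - s *\<^sub>R a) \<le> R \<and>
         \<alpha> * s\<^sup>2 \<le> u (x + (s *\<^sub>R a + d)) + u (x + (e - s *\<^sub>R a)) - 2 * u x
                    - p \<bullet> (d + e) - N * ((norm d)\<^sup>2 + (norm e)\<^sup>2)) \<or>
      (\<exists>v g. norm (v - x) < \<delta> / 2 \<and> norm (g - p) < \<delta> / 2 \<and>
         (\<forall>\<^sub>F w in nhds v. u w \<le> u v + g \<bullet> (w - v) + (w - v) \<bullet> H (w - v) / 2))"
      by (rule second_difference_or_touching[OF R(1) continuous_on_subset[OF contu R(2)] upper C False])
         (use \<delta> in \<open>auto simp: H k_def\<close>)
    then show ?thesis
      by (rule eventually_mono) (use no_touch in blast)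
  qed
qed

text \<open>Reflection carries the bound for subsolutions over to supersolutions. As
  \<open>B\<close> enters quadratically, its own sign is immaterial; only \<open>c\<close>,
  \<open>h\<close> and the Hessian change sign.\<close>

lemma visc_super_imp_visc_sub_uminus:
  assumes "visc_super \<Omega> B c h u"
  shows "visc_sub \<Omega> (\<lambda>(x, r, q). B (x, - r, - q)) (\<lambda>(x, r, q). - c (x, - r, - q)) (\<lambda>x. - h x) (\<lambda>x. - u x)"
  unfolding visc_sub_def Let_def
proof (intro conjI allI impI; (elim conjE)?)
  show "continuous_on \<Omega> (\<lambda>x. - u x)"
    using assms by (auto simp: visc_super_def intro: continuous_intros)
next
  fix phi Dphi Hphi x0
  assume C2: "C2_test \<Omega> phi Dphi Hphi" and x0: "x0 \<in> \<Omega>"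
    and max: "local_max_on \<Omega> (\<lambda>x. - u x - phi x) x0"
  have "C2_test \<Omega> (\<lambda>x. - phi x) (\<lambda>x. - Dphi x) (\<lambda>x. - Hphi x)"
    using C2 unfolding C2_test_def
    by (auto intro!: GDERIV_minus continuous_intros has_derivative_minus simp: uminus_blinfun.rep_eq)
  moreover have "local_min_on \<Omega> (\<lambda>x. u x - - phi x) x0"
    using max by (auto simp: local_max_on_def local_min_on_def algebra_simps)
  ultimately show "- h x0 \<le> (case (x0, - u x0, Dphi x0) of (x, r, q) \<Rightarrow> B (x, - r, - q)) \<bullet>
      Hphi x0 (case (x0, - u x0, Dphi x0) of (x, r, q) \<Rightarrow> B (x, - r, - q)) +
      (case (x0, - u x0, Dphi x0) of (x, r, q) \<Rightarrow> - c (x, - r, - q))"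
    using assms x0 unfolding visc_super_def Let_def
    by (fastforce simp: uminus_blinfun.rep_eq)
qed

section \<open>Comparison at a maximum pair\<close>

text \<open>The hypothesis \<open>max\<close> is the maximality of the doubled function at
  \<open>(x, y)\<close>, written in displacements. The second difference bounds for \<open>u\<close>
  at \<open>x\<close> and for \<open>- u\<close> at \<open>y\<close>, taken with the same
  \<open>s\<close>, are added. Applying \<open>max\<close> to both displaced pairs bounds their sum
  from above: the first-order terms cancel and the transversal terms are absorbed by
  \<open>N\<close>.\<close>

lemma visc_gap_le:
  fixes u :: "real^'n \<Rightarrow> real"
  assumes "open \<Omega>" and contB: "continuous_on (\<Omega> \<times> UNIV \<times> UNIV) B"
    and contc: "continuous_on (\<Omega> \<times> UNIV \<times> UNIV) c"
    and sub: "visc_sub \<Omega> B c (\<lambda>_. \<tau>1) u" and super: "visc_super \<Omega> B c (\<lambda>_. \<tau>2) u"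
    and R: "R > 0" "cball x R \<subseteq> \<Omega>" "cball y R \<subseteq> \<Omega>" and \<epsilon>: "\<epsilon> > 0" and \<eta>: "\<eta> \<ge> 0"
    and max: "\<And>d e. norm d \<le> R \<Longrightarrow> norm e \<le> R \<Longrightarrow>
       u (x + d) - u (y + e) \<le> u x - u y + p \<bullet> d - p' \<bullet> e + (norm (d - e))\<^sup>2 / (2 * \<epsilon>) + \<eta> * (norm d)\<^sup>2"
    and a: "a = B (x, u x, p)" and b: "b = B (y, u y, p')"
  shows "\<tau>1 - \<tau>2 \<le> c (x, u x, p) - c (y, u y, p') + 3 * (norm (a - b))\<^sup>2 / \<epsilon> + 4 * \<eta> * (norm a)\<^sup>2"
proof (rule ccontr)
  assume neg: "\<not> ?thesis"
  define \<kappa> where "\<kappa> = 3 * (norm (a - b))\<^sup>2 / \<epsilon> + 4 * \<eta> * (norm a)\<^sup>2"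
  \<comment> \<open>A quarter of the assumed excess: \<open>\<alpha>\<close> and
    \<open>\<beta>\<close> each give up \<open>\<theta>\<close> to make their bounds strict, and
    their sum still exceeds \<open>\<kappa>\<close> by \<open>2 * \<theta>\<close>.\<close>
  define \<theta> where "\<theta> = (\<tau>1 - \<tau>2 - (c (x, u x, p) - c (y, u y, p') + \<kappa>)) / 4"
  have \<theta>: "\<theta> > 0" using neg by (simp add: \<theta>_def \<kappa>_def)
  define \<alpha> where "\<alpha> = \<tau>1 - c (x, u x, p) - \<theta>"
  define \<beta> where "\<beta> = c (y, u y, p') - \<tau>2 - \<theta>"
  \<comment> \<open>The factors 3 and 2 are those of \<open>sq3\<close> and \<open>sq2\<close>
    below, so that \<open>N\<close> pays for the transversal part of the penalty.\<close>
  define N where "N = 3 / (2 * \<epsilon>) + 2 * \<eta>"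
  have N: "1 / (2 * \<epsilon>) + 2 * \<eta> < N" unfolding N_def
    using \<epsilon> by (intro add_strict_right_mono divide_strict_right_mono) auto
  have *: "\<forall>\<^sub>F s in at_right 0. \<exists>d e. norm (s *\<^sub>R a + d) \<le> R \<and> norm (e - s *\<^sub>R a) \<le> R \<and>
       \<alpha> * s\<^sup>2 \<le> u (x + (s *\<^sub>R a + d)) + u (x + (e - s *\<^sub>R a)) - 2 * u x
                  - p \<bullet> (d + e) - N * ((norm d)\<^sup>2 + (norm e)\<^sup>2)"
  proof (rule visc_sub_second_difference[OF \<open>open \<Omega>\<close> contB contc sub R(1,2) _ _ _ a])
    show "u (x + d) \<le> u x + p \<bullet> d + (1 / (2 * \<epsilon>) + \<eta>) * (norm d)\<^sup>2" if "norm d \<le> R" for d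
      using max[of d 0] that R by (simp add: algebra_simps)
    show "1 / (2 * \<epsilon>) + \<eta> < N" using N \<eta> by simp
  qed (use \<epsilon> \<eta> \<theta> in \<open>auto simp: \<alpha>_def\<close>)
  have **: "\<forall>\<^sub>F s in at_right 0. \<exists>d e. norm (s *\<^sub>R b + d) \<le> R \<and> norm (e - s *\<^sub>R b) \<le> R \<and>
       \<beta> * s\<^sup>2 \<le> - u (y + (s *\<^sub>R b + d)) + - u (y + (e - s *\<^sub>R b)) - 2 * - u y
                  - (- p') \<bullet> (d + e) - N * ((norm d)\<^sup>2 + (norm e)\<^sup>2)"
  proof (rule visc_sub_second_difference[OF \<open>open \<Omega>\<close> _ _ visc_super_imp_visc_sub_uminus[OF super] R(1,3)])
    show "- u (y + e) \<le> - u y + (- p') \<bullet> e + (1 / (2 * \<epsilon>)) * (norm e)\<^sup>2" if "norm e \<le> R" for e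
      using max[of 0 e] that R by (simp add: algebra_simps)
    show "1 / (2 * \<epsilon>) < N" using N \<eta> by simp
    show "continuous_on (\<Omega> \<times> UNIV \<times> UNIV) (\<lambda>(x, r, q). B (x, - r, - q))"
         "continuous_on (\<Omega> \<times> UNIV \<times> UNIV) (\<lambda>(x, r, q). - c (x, - r, - q))"
      unfolding case_prod_beta
      by (intro continuous_intros continuous_on_compose2[OF contB] continuous_on_compose2[OF contc]; auto)+
  qed (use \<epsilon> \<theta> b in \<open>auto simp: \<beta>_def\<close>)
  have "\<forall>\<^sub>F s :: real in at_right 0. s > 0"
    by (rule eventually_at_right_less)
  with * ** have "\<forall>\<^sub>F s :: real in at_right 0. False"
  proof eventually_elim
    case (elim s)
    obtain d1 d2 where d: "norm (s *\<^sub>R a + d1) \<le> R" "norm (d2 - s *\<^sub>R a) \<le> R"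
       "\<alpha> * s\<^sup>2 \<le> u (x + (s *\<^sub>R a + d1)) + u (x + (d2 - s *\<^sub>R a)) - 2 * u x
                  - p \<bullet> (d1 + d2) - N * ((norm d1)\<^sup>2 + (norm d2)\<^sup>2)"
      using elim(1) by blast
    obtain e1 e2 where e: "norm (s *\<^sub>R b + e1) \<le> R" "norm (e2 - s *\<^sub>R b) \<le> R"
       "\<beta> * s\<^sup>2 \<le> - u (y + (s *\<^sub>R b + e1)) + - u (y + (e2 - s *\<^sub>R b)) - 2 * - u y
                  - (- p') \<bullet> (e1 + e2) - N * ((norm e1)\<^sup>2 + (norm e2)\<^sup>2)"
      using elim(2) by blast
    have sq3: "(norm (f + g - h))\<^sup>2 \<le> 3 * ((norm f)\<^sup>2 + (norm g)\<^sup>2 + (norm h)\<^sup>2)" for f g h :: "real^'n"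
    proof -
      have "0 \<le> (norm (f - g))\<^sup>2 + (norm (f + h))\<^sup>2 + (norm (g + h))\<^sup>2" by simp
      then show ?thesis
        unfolding power2_norm_eq_inner
        by (simp add: inner_add_left inner_add_right inner_diff_left inner_diff_right inner_commute)
    qed
    have sq2: "(norm (f + g))\<^sup>2 \<le> 2 * ((norm f)\<^sup>2 + (norm g)\<^sup>2)" for f g :: "real^'n"
    proof -
      have "0 \<le> (norm (f - g))\<^sup>2" by simp
      then show ?thesis
        unfolding power2_norm_eq_inner
        by (simp add: inner_add_left inner_add_right inner_diff_left inner_diff_right inner_commute)
    qed
    \<comment> \<open>Used with \<open>r = s\<close> and with \<open>r = - s\<close>; the two halves
      of \<open>\<kappa>\<close> add up.\<close>
    have pen: "(norm (r *\<^sub>R a + f - (r *\<^sub>R b + g)))\<^sup>2 / (2 * \<epsilon>) + \<eta> * (norm (r *\<^sub>R a + f))\<^sup>2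
        \<le> \<kappa> / 2 * r\<^sup>2 + N * ((norm f)\<^sup>2 + (norm g)\<^sup>2)" for r f g
    proof -
      have eq: "r *\<^sub>R a + f - (r *\<^sub>R b + g) = r *\<^sub>R (a - b) + f - g"
        by (simp add: algebra_simps)
      have "(norm (r *\<^sub>R a + f - (r *\<^sub>R b + g)))\<^sup>2 / (2 * \<epsilon>)
          \<le> 3 * (r\<^sup>2 * (norm (a - b))\<^sup>2 + (norm f)\<^sup>2 + (norm g)\<^sup>2) / (2 * \<epsilon>)"
        unfolding eq using sq3[of "r *\<^sub>R (a - b)" f g] \<epsilon>
        by (intro divide_right_mono) (auto simp: power_mult_distrib)
      moreover have "\<eta> * (norm (r *\<^sub>R a + f))\<^sup>2 \<le> \<eta> * (2 * (r\<^sup>2 * (norm a)\<^sup>2 + (norm f)\<^sup>2))"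
        using sq2[of "r *\<^sub>R a" f] \<eta> by (intro mult_left_mono) (auto simp: power_mult_distrib)
      moreover have "\<kappa> / 2 * r\<^sup>2 + N * ((norm f)\<^sup>2 + (norm g)\<^sup>2) =
          3 * (r\<^sup>2 * (norm (a - b))\<^sup>2 + (norm f)\<^sup>2 + (norm g)\<^sup>2) / (2 * \<epsilon>)
          + \<eta> * (2 * (r\<^sup>2 * (norm a)\<^sup>2 + (norm f)\<^sup>2)) + 2 * \<eta> * (norm g)\<^sup>2"
        using \<epsilon> by (simp add: \<kappa>_def N_def field_simps)
      ultimately show ?thesis using \<eta> by (smt (verit) mult_nonneg_nonneg zero_le_power2)
    qed
    have "u (x + (s *\<^sub>R a + d1)) - u (y + (s *\<^sub>R b + e1)) \<le> u x - u y
        + p \<bullet> (s *\<^sub>R a + d1) - p' \<bullet> (s *\<^sub>R b + e1) + \<kappa> / 2 * s\<^sup>2 + N * ((norm d1)\<^sup>2 + (norm e1)\<^sup>2)"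
      using max[OF d(1) e(1)] pen[of s d1 e1] by simp
    moreover have "u (x + (d2 - s *\<^sub>R a)) - u (y + (e2 - s *\<^sub>R b)) \<le> u x - u y
        + p \<bullet> (d2 - s *\<^sub>R a) - p' \<bullet> (e2 - s *\<^sub>R b) + \<kappa> / 2 * s\<^sup>2 + N * ((norm d2)\<^sup>2 + (norm e2)\<^sup>2)"
      using max[OF d(2) e(2)] pen[of "- s" d2 e2] by simp
    ultimately have "(\<alpha> + \<beta>) * s\<^sup>2 \<le> \<kappa> * s\<^sup>2"
      using d(3) e(3) by (simp add: inner_add_right inner_diff_right algebra_simps)
    then have "\<alpha> + \<beta> \<le> \<kappa>" using elim(3) by simp
    moreover have "\<alpha> + \<beta> = \<kappa> + 2 * \<theta>"
      by (simp add: \<alpha>_def \<beta>_def \<theta>_def field_simps)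
    ultimately show False using \<theta> by simp
  qed
  then show False by (simp add: trivial_limit_at_right_real)
qed

section \<open>Doubling of variables\<close>

theorem lemma3p1:
  fixes \<Omega> :: "(real^'n) set"
    and B :: "(real^'n) \<times> real \<times> (real^'n) \<Rightarrow> real^'n"
    and c :: "(real^'n) \<times> real \<times> (real^'n) \<Rightarrow> real"
    and \<tau>1 \<tau>2 :: real
  assumes "open \<Omega>" and "bounded \<Omega>" and "\<Omega> \<noteq> {}"
    and "C1_on (\<Omega> \<times> UNIV \<times> UNIV) B"
    and "continuous_on (\<Omega> \<times> UNIV \<times> UNIV) c"
    and "\<tau>2 < \<tau>1"
  shows "\<not> (\<exists>u :: real^'n \<Rightarrow> real.
            (\<exists>L. L-lipschitz_on (closure \<Omega>) u) \<and>
            visc_sub \<Omega> B c (\<lambda>_. \<tau>1) u \<and>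
            visc_super \<Omega> B c (\<lambda>_. \<tau>2) u \<and>
            (\<forall>x\<in>frontier \<Omega>. u x = 0))"
proof
  assume "\<exists>u :: real^'n \<Rightarrow> real.
            (\<exists>L. L-lipschitz_on (closure \<Omega>) u) \<and>
            visc_sub \<Omega> B c (\<lambda>_. \<tau>1) u \<and>
            visc_super \<Omega> B c (\<lambda>_. \<tau>2) u \<and>
            (\<forall>x\<in>frontier \<Omega>. u x = 0)"
  then obtain u :: "real^'n \<Rightarrow> real" and L where lip: "L-lipschitz_on (closure \<Omega>) u"
    and sub: "visc_sub \<Omega> B c (\<lambda>_. \<tau>1) u" and super: "visc_super \<Omega> B c (\<lambda>_. \<tau>2) u"
    by blast
  have L: "L \<ge> 0" using lip by (rule lipschitz_on_nonneg)
  obtain z where "z \<in> \<Omega>" using \<open>\<Omega> \<noteq> {}\<close> by blast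
  then obtain r where r: "r > 0" "cball z r \<subseteq> \<Omega>"
    using \<open>open \<Omega>\<close> open_contains_cball by blast
  have u_lip: "\<bar>u v - u w\<bar> \<le> L * norm (v - w)" if "v \<in> cball z r" "w \<in> cball z r" for v w
  proof -
    have "v \<in> closure \<Omega>" "w \<in> closure \<Omega>" using that r closure_subset by blast+
    then show ?thesis using lipschitz_onD[OF lip, of v w] by (simp add: dist_norm)
  qed
  have u_cont: "continuous_on (cball z r) u"
    using sub r by (auto simp: visc_sub_def intro: continuous_on_subset)
  obtain B' where B': "\<And>v. v \<in> \<Omega> \<times> UNIV \<times> UNIV \<Longrightarrow> (B has_derivative blinfun_apply (B' v)) (at v)"
    and B'_cont: "continuous_on (\<Omega> \<times> UNIV \<times> UNIV) B'"
    using \<open>C1_on (\<Omega> \<times> UNIV \<times> UNIV) B\<close> unfolding C1_on_def by blast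
  have B_cont: "continuous_on (\<Omega> \<times> UNIV \<times> UNIV) B"
    using B' by (meson continuous_at_imp_continuous_on has_derivative_continuous)

  \<comment> \<open>\<open>K\<close> will contain the arguments of \<open>B\<close> and
    \<open>c\<close> at both maximum points, whose slopes are at most \<open>2 * L + 2 * r\<close>
    in norm. Its convexity gives the mean value inequality for \<open>B\<close>.\<close>
  define K where "K = cball z r \<times> cball (u z) (L * r) \<times> cball (0 :: real^'n) (2 * L + 2 * r)"
  have K: "compact K" "convex K" "K \<subseteq> \<Omega> \<times> UNIV \<times> UNIV"
    using r by (auto simp: K_def intro!: compact_Times convex_Times)
  have "bounded (B' ` K)" "bounded (B ` K)"
    using K B'_cont B_cont
    by (meson compact_continuous_image compact_imp_bounded continuous_on_subset)+
  then obtain \<Lambda> A where \<Lambda>: "\<And>v. v \<in> K \<Longrightarrow> norm (B' v) \<le> \<Lambda>" and A: "\<And>v. v \<in> K \<Longrightarrow> norm (B v) \<le> A"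
    unfolding bounded_iff by auto
  have B_lip: "norm (B v - B w) \<le> \<Lambda> * norm (v - w)" if "v \<in> K" "w \<in> K" for v w
  proof (rule differentiable_bound[OF K(2) _ _ that])
    show "(B has_derivative blinfun_apply (B' v)) (at v within K)" if "v \<in> K" for v
      using B' K(3) that by (blast intro: has_derivative_at_withinI)
    show "onorm (blinfun_apply (B' v)) \<le> \<Lambda>" if "v \<in> K" for v
      using \<Lambda>[OF that] by (simp add: norm_blinfun.rep_eq)
  qed
  \<comment> \<open>One half of the gap absorbs the oscillation of \<open>c\<close>, the other half
    the remaining error terms.\<close>
  define \<theta> where "\<theta> = (\<tau>1 - \<tau>2) / 2"
  have \<theta>: "\<theta> > 0" using \<open>\<tau>2 < \<tau>1\<close> by (simp add: \<theta>_def)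
  have "uniformly_continuous_on K c"
    using assms(5) K by (intro compact_uniformly_continuous) (auto intro: continuous_on_subset)
  then obtain \<delta> where \<delta>: "\<delta> > 0"
    and c_unif: "\<And>v w. v \<in> K \<Longrightarrow> w \<in> K \<Longrightarrow> norm (v - w) < \<delta> \<Longrightarrow> \<bar>c v - c w\<bar> < \<theta>"
    using \<theta> unfolding uniformly_continuous_on_def dist_norm by (metis real_norm_def)

  \<comment> \<open>\<open>M * \<eta>\<close> will bound the distance between the two arguments.
    With \<open>\<epsilon> = t ^ 4\<close> and \<open>\<eta> = t ^ 3\<close>, the four limits
    control in turn this distance, the error terms from \<open>B\<close> and \<open>\<eta>\<close>,
    the distance of \<open>x\<close> from \<open>z\<close>, and that of \<open>y\<close> from
    \<open>x\<close>.\<close>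
  define M where "M = 2 * L * (1 + L) + 2 * r"
  have lim: "((\<lambda>t :: real. M * t ^ 3) \<longlongrightarrow> 0) (at_right 0)"
    "((\<lambda>t :: real. 3 * (\<Lambda> * M)\<^sup>2 * t\<^sup>2 + 4 * A\<^sup>2 * t ^ 3) \<longlongrightarrow> 0) (at_right 0)"
    "((\<lambda>t :: real. 2 * L\<^sup>2 * t) \<longlongrightarrow> 0) (at_right 0)"
    "((\<lambda>t :: real. 2 * L * t ^ 4) \<longlongrightarrow> 0) (at_right 0)"
    by (auto intro!: tendsto_eq_intros)
  have "\<forall>\<^sub>F t :: real in at_right 0. 0 < t \<and> t < 1"
    by (intro eventually_conj eventually_at_right_less eventually_at_rightI[of 0 1]) auto
  moreover have "\<forall>\<^sub>F t in at_right 0. M * t ^ 3 < \<delta>"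
    using order_tendstoD(2)[OF lim(1) \<delta>] .
  moreover have "\<forall>\<^sub>F t in at_right 0. 3 * (\<Lambda> * M)\<^sup>2 * t\<^sup>2 + 4 * A\<^sup>2 * t ^ 3 < \<theta>"
    using order_tendstoD(2)[OF lim(2) \<theta>] .
  moreover have "\<forall>\<^sub>F t in at_right 0. 2 * L\<^sup>2 * t < (r / 2)\<^sup>2"
    using order_tendstoD(2)[OF lim(3)] r by simp
  moreover have "\<forall>\<^sub>F t in at_right 0. 2 * L * t ^ 4 < r / 2"
    using order_tendstoD(2)[OF lim(4) half_gt_zero[OF r(1)]] .
  ultimately have "\<forall>\<^sub>F t in at_right 0. 0 < t \<and> t < 1 \<and> M * t ^ 3 < \<delta> \<and>
      3 * (\<Lambda> * M)\<^sup>2 * t\<^sup>2 + 4 * A\<^sup>2 * t ^ 3 < \<theta> \<and> 2 * L\<^sup>2 * t < (r / 2)\<^sup>2 \<and> 2 * L * t ^ 4 < r / 2"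
    by eventually_elim simp
  then obtain t :: real where t: "0 < t" "t < 1" "M * t ^ 3 < \<delta>"
    "3 * (\<Lambda> * M)\<^sup>2 * t\<^sup>2 + 4 * A\<^sup>2 * t ^ 3 < \<theta>" "2 * L\<^sup>2 * t < (r / 2)\<^sup>2" "2 * L * t ^ 4 < r / 2"
    using eventually_happens'[OF trivial_limit_at_right_real] by blast

  \<comment> \<open>\<open>\<epsilon> \<ll> \<eta>\<close> keeps the maximum point near \<open>z\<close>, and \<open>\<eta>\<^sup>2 \<ll> \<epsilon>\<close> makes \<open>|a - b|\<^sup>2 / \<epsilon>\<close> small.\<close>
  define \<epsilon> where "\<epsilon> = t ^ 4"
  define \<eta> where "\<eta> = t ^ 3"
  have \<epsilon>: "\<epsilon> > 0" and \<eta>: "\<eta> > 0" "\<eta> \<le> 1"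
    using t(1,2) by (auto simp: \<epsilon>_def \<eta>_def intro: power_le_one)
  have \<epsilon>_t: "\<epsilon> = \<eta> * t" "\<epsilon> \<le> \<eta>"
    using t(1,2) by (auto simp: \<epsilon>_def \<eta>_def power_decreasing simp flip: power_Suc2)
  define \<Phi> where "\<Phi> = (\<lambda>(v, w). u v - u w - (norm (v - w))\<^sup>2 / (2 * \<epsilon>) - \<eta> * (norm (v - z))\<^sup>2)"
  have "continuous_on (cball z r \<times> cball z r) \<Phi>"
    unfolding \<Phi>_def case_prod_beta using \<epsilon>
    by (intro continuous_intros continuous_on_compose2[OF u_cont]) auto
  then have "\<exists>v\<in>cball z r \<times> cball z r. \<forall>w\<in>cball z r \<times> cball z r. \<Phi> w \<le> \<Phi> v"
    using r by (intro continuous_attains_sup compact_Times) auto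
  then obtain x y where x: "x \<in> cball z r" and y: "y \<in> cball z r"
    and max: "\<And>v w. v \<in> cball z r \<Longrightarrow> w \<in> cball z r \<Longrightarrow> \<Phi> (v, w) \<le> \<Phi> (x, y)"
    by auto
  \<comment> \<open>Comparison with the diagonal point \<open>(x, x)\<close>, where the
    \<open>\<eta>\<close> terms cancel.\<close>
  have "(norm (x - y))\<^sup>2 / (2 * \<epsilon>) \<le> u x - u y"
    using max[OF x x] by (simp add: \<Phi>_def)
  also have "\<dots> \<le> L * norm (x - y)" using u_lip[OF x y] by simp
  finally have "norm (x - y) * norm (x - y) \<le> 2 * L * \<epsilon> * norm (x - y)"
    using \<epsilon> by (simp add: field_simps power2_eq_square)
  then have xy: "norm (x - y) \<le> 2 * L * \<epsilon>"
    using L \<epsilon> by (cases "x = y") auto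
  \<comment> \<open>Comparison with \<open>(z, z)\<close>, where \<open>\<Phi>\<close>
    vanishes.\<close>
  have "\<eta> * (norm (x - z))\<^sup>2 \<le> u x - u y - (norm (x - y))\<^sup>2 / (2 * \<epsilon>)"
    using max[of z z] r by (simp add: \<Phi>_def)
  also have "\<dots> \<le> u x - u y" using \<epsilon> by simp
  also have "\<dots> \<le> L * norm (x - y)" using u_lip[OF x y] by simp
  also have "\<dots> \<le> L * (2 * L * \<epsilon>)" using xy L by (intro mult_left_mono) auto
  also have "\<dots> = \<eta> * (2 * L\<^sup>2 * t)" by (simp add: \<epsilon>_t power2_eq_square)
  finally have "(norm (x - z))\<^sup>2 < (r / 2)\<^sup>2" using \<eta> t by simp
  then have xz: "norm (x - z) < r / 2" by (rule power2_less_imp_less) (use r in simp)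
  then have yz: "norm (y - z) < r"
    using xy t norm_triangle_ineq4[of "x - z" "x - y"] by (simp add: \<epsilon>_def)

  define R where "R = r - max (norm (x - z)) (norm (y - z))"
  have R: "R > 0" using xz yz r by (simp add: R_def)
  have Rx: "x + d \<in> cball z r" and Ry: "y + d \<in> cball z r" if "norm d \<le> R" for d
    using that norm_triangle_ineq[of "x - z" d] norm_triangle_ineq[of "y - z" d]
    by (auto simp: R_def dist_norm norm_minus_commute[of z] algebra_simps)
  have cballR: "cball x R \<subseteq> \<Omega>" "cball y R \<subseteq> \<Omega>"
    using Rx[of "_ - x"] Ry[of "_ - y"] r by (auto simp: dist_norm norm_minus_commute)
  \<comment> \<open>\<open>p\<close> and \<open>- p'\<close> are the gradients of the penalty in its
    first and second variable.\<close>
  define p' where "p' = (1 / \<epsilon>) *\<^sub>R (x - y)"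
  define p where "p = p' + (2 * \<eta>) *\<^sub>R (x - z)"
  have gap: "\<tau>1 - \<tau>2 \<le> c (x, u x, p) - c (y, u y, p')
      + 3 * (norm (B (x, u x, p) - B (y, u y, p')))\<^sup>2 / \<epsilon> + 4 * \<eta> * (norm (B (x, u x, p)))\<^sup>2"
  proof (rule visc_gap_le[OF \<open>open \<Omega>\<close> B_cont assms(5) sub super R cballR \<epsilon> less_imp_le[OF \<eta>(1)] _ refl refl])
    fix d e :: "real^'n" assume "norm d \<le> R" "norm e \<le> R"
    then have "\<Phi> (x + d, y + e) \<le> \<Phi> (x, y)" by (intro max Rx Ry)
    moreover have "(norm (x + d - (y + e)))\<^sup>2 / (2 * \<epsilon>)
        = (norm (x - y))\<^sup>2 / (2 * \<epsilon>) + p' \<bullet> (d - e) + (norm (d - e))\<^sup>2 / (2 * \<epsilon>)"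
    proof -
      have "x + d - (y + e) = (x - y) + (d - e)" by simp
      then show ?thesis
        unfolding p'_def power2_norm_eq_inner using \<epsilon>
        by (simp only: inner_add_left inner_add_right inner_commute[of "d - e" "x - y"] inner_scaleR_left)
           (simp add: field_simps)
    qed
    moreover have "(norm (x + d - z))\<^sup>2 = (norm (x - z))\<^sup>2 + 2 * ((x - z) \<bullet> d) + (norm d)\<^sup>2"
      unfolding power2_norm_eq_inner
      by (simp add: inner_add_left inner_add_right inner_diff_left inner_diff_right inner_commute)
    ultimately show "u (x + d) - u (y + e) \<le> u x - u y + p \<bullet> d - p' \<bullet> e
        + (norm (d - e))\<^sup>2 / (2 * \<epsilon>) + \<eta> * (norm d)\<^sup>2"
      by (simp add: \<Phi>_def p_def inner_add_left inner_diff_right ring_distribs)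
  qed

  have "norm p' \<le> 2 * L" using xy \<epsilon> by (simp add: p'_def pos_divide_le_eq)
  moreover have pp': "norm (p - p') \<le> 2 * r * \<eta>"
    using x \<eta> by (simp add: p_def dist_norm norm_minus_commute)
  moreover have "2 * r * \<eta> \<le> 2 * r" using \<eta> r by simp
  ultimately have "norm p \<le> 2 * L + 2 * r"
    using norm_triangle_ineq[of p' "p - p'"] by simp
  moreover have "\<bar>u v - u z\<bar> \<le> L * r" if "v \<in> cball z r" for v
    using u_lip[OF that, of z] that r L mult_left_mono[of "norm (v - z)" r L]
    by (simp add: dist_norm norm_minus_commute)
  ultimately have in_K: "(x, u x, p) \<in> K" "(y, u y, p') \<in> K"
    using x y r \<open>norm p' \<le> 2 * L\<close> by (auto simp: K_def dist_real_def abs_minus_commute)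
  have "norm ((x, u x, p) - (y, u y, p')) \<le> norm (x - y) + (\<bar>u x - u y\<bar> + norm (p - p'))"
    using norm_Pair_le[of "x - y" "(u x - u y, p - p')"] norm_Pair_le[of "u x - u y" "p - p'"] by simp
  also have "\<dots> \<le> (1 + L) * norm (x - y) + 2 * r * \<eta>"
    using u_lip[OF x y] pp' by (simp add: ring_distribs)
  also have "\<dots> \<le> (1 + L) * (2 * L * \<eta>) + 2 * r * \<eta>"
  proof -
    have "2 * L * \<epsilon> \<le> 2 * L * \<eta>" using L \<epsilon>_t by (intro mult_left_mono) auto
    then show ?thesis using xy L by (intro add_right_mono mult_left_mono) auto
  qed
  finally have dist_K: "norm ((x, u x, p) - (y, u y, p')) \<le> M * \<eta>"
    by (simp add: M_def algebra_simps)

  have "c (x, u x, p) - c (y, u y, p') < \<theta>"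
    using c_unif[OF in_K] dist_K t by (simp add: \<eta>_def)
  moreover have "3 * (norm (B (x, u x, p) - B (y, u y, p')))\<^sup>2 / \<epsilon> \<le> 3 * (\<Lambda> * M)\<^sup>2 * t\<^sup>2"
  proof -
    have "\<Lambda> \<ge> 0" using \<Lambda>[OF in_K(1)] norm_ge_zero order_trans by blast
    then have "norm (B (x, u x, p) - B (y, u y, p')) \<le> \<Lambda> * M * \<eta>"
      using B_lip[OF in_K] mult_left_mono[OF dist_K, of \<Lambda>] by (simp add: mult.assoc)
    then have "(norm (B (x, u x, p) - B (y, u y, p')))\<^sup>2 \<le> (\<Lambda> * M * \<eta>)\<^sup>2"
      by (intro power_mono) auto
    \<comment> \<open>\<open>\<eta>\<^sup>2 = t\<^sup>2 * \<epsilon>\<close>, so division by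
      \<open>\<epsilon>\<close> leaves the small factor \<open>t\<^sup>2\<close>.\<close>
    also have "\<dots> = (\<Lambda> * M)\<^sup>2 * t\<^sup>2 * \<epsilon>"
      by (simp add: \<eta>_def \<epsilon>_def power_mult_distrib flip: power_mult power_add)
    finally show ?thesis using \<epsilon> by (simp add: field_simps)
  qed
  moreover have "4 * \<eta> * (norm (B (x, u x, p)))\<^sup>2 \<le> 4 * A\<^sup>2 * t ^ 3"
  proof -
    have "(norm (B (x, u x, p)))\<^sup>2 \<le> A\<^sup>2" using A[OF in_K(1)] by (intro power_mono) auto
    then show ?thesis using \<eta> by (simp add: \<eta>_def mult.commute)
  qed
  ultimately show False using gap t(4) by (simp add: \<theta>_def)
qed

end
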